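(* Let $k,n$ be positive integers and let $i$ be an integer with $0\le i<k$. For any choice of strip for $(k,n,i)$ (that is, any choice of which points of the upper boundary belong to the strip), the number of good paths is $k+1-i$ times the number of good paths that start with an up-step.
   Context: All paths are lattice paths in $\mathbb{Z}^2$ composed only of unit steps to the right $(1,0)$ and up $(0,1)$. Fix positive integers $k,n$ and an integer $i$ with $0\le i<k$. For a point $(x,y)$ let $d((x,y))=ky-x$, the signed horizontal distance from $(x,y)$ to the line $y=x/k$. The strip: it consists of all lattice points $p\notin\{(0,0),(kn-i,n)\}$ such that $0\le d(p)<i$, together with an arbitrary (chosen and fixed) subset of the lattice points $p\notin\{(0,0),(kn-i,n)\}$ on the upper boundary $d(p)=i$. Points in the strip are called forbidden. A good path is a path from $(0,0)$ to $(kn-i,n)$ that avoids all forbidden points. *)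

theory Defs
  imports Main "HOL-Library.Product_Plus"
begin

type_synonym point = "int \<times> int"

datatype step = R | U

fun step_vec :: "step \<Rightarrow> point" where
  "step_vec R = (1, 0)"
| "step_vec U = (0, 1)"

text \<open>A lattice path is given by its starting point and its list of steps;
  \<open>vertices a w\<close> lists all lattice points visited, both endpoints included.\<close>

fun vertices :: "point \<Rightarrow> step list \<Rightarrow> point list" where
  "vertices a [] = [a]"
| "vertices a (s # w) = a # vertices (a + step_vec s) w"

definition path_from_to :: "point \<Rightarrow> point \<Rightarrow> step list \<Rightarrow> bool" where
  "path_from_to a b w \<longleftrightarrow> last (vertices a w) = b"

definition hdist :: "int \<Rightarrow> point \<Rightarrow> int" where
  "hdist k p = k * snd p - fst p"

definition target :: "int \<Rightarrow> int \<Rightarrow> int \<Rightarrow> point" where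
  "target k n i = (k * n - i, n)"

text \<open>The sets \<open>S\<close> that are a strip for \<open>(k, n, i)\<close>: the set \<open>B\<close> is the
  chosen part of the upper boundary.\<close>

definition is_strip :: "int \<Rightarrow> int \<Rightarrow> int \<Rightarrow> point set \<Rightarrow> bool" where
  "is_strip k n i S \<longleftrightarrow>
     (\<exists>B. B \<subseteq> {p. p \<notin> {(0, 0), target k n i} \<and> hdist k p = i} \<and>
          S = {p. p \<notin> {(0, 0), target k n i} \<and> 0 \<le> hdist k p \<and> hdist k p < i} \<union> B)"

definition good_paths :: "int \<Rightarrow> int \<Rightarrow> int \<Rightarrow> point set \<Rightarrow> step list set" where
  "good_paths k n i S =
     {w. path_from_to (0, 0) (target k n i) w \<and> set (vertices (0, 0) w) \<inter> S = {}}"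

definition starts_up :: "step list \<Rightarrow> bool" where
  "starts_up w \<longleftrightarrow> w \<noteq> [] \<and> hd w = U"

lemma vertices_nonempty [simp]: "vertices a w \<noteq> []"
  by (cases w) auto

lemma length_eq_coordinate_sum:
  "fst (last (vertices a w)) + snd (last (vertices a w)) = fst a + snd a + int (length w)"
proof (induction w arbitrary: a)
  case (Cons s w)
  then show ?case by (cases s) auto
qed simp

lemma finite_good_paths: "finite (good_paths k n i S)"
proof (rule finite_subset)
  let ?m = "nat (k * n - i + n)"
  have univ: "(UNIV :: step set) = {R, U}"
    using step.exhaust by auto
  show "good_paths k n i S \<subseteq> {w. set w \<subseteq> UNIV \<and> length w = ?m}"
  proof
    fix w assume "w \<in> good_paths k n i S"
    then have "last (vertices (0, 0) w) = (k * n - i, n)"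
      by (simp add: good_paths_def path_from_to_def target_def)
    with length_eq_coordinate_sum[of "(0, 0)" w]
    show "w \<in> {w. set w \<subseteq> UNIV \<and> length w = ?m}" by simp
  qed
  have "finite (UNIV :: step set)" unfolding univ by simp
  then show "finite {w :: step list. set w \<subseteq> UNIV \<and> length w = ?m}"
    by (rule finite_lists_length_eq)
qed

end

theory Submission
  imports Defs
begin

text \<open>A good path that starts with a right-step has \<open>hdist < 0\<close> until some up-step takes it to a
  point \<open>p\<close> with \<open>i \<le> hdist k p < k\<close>, because \<open>p\<close> must clear the strip. Write the path as
  \<open>A @ U # B\<close> accordingly. Then \<open>U # rev A @ B\<close> is a good path that starts with an up-step, and it
  reaches the level \<open>m = hdist k p\<close> for the first time at the same point \<open>p\<close>, so that the part \<open>B\<close>,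
  the only one that can touch the upper boundary, does not move. Conversely, as right-steps lower
  \<open>hdist\<close> by one, a good path that starts with an up-step has a first visit to every one of the
  \<open>k - i\<close> levels \<open>i \<le> m < k\<close>.\<close>

section \<open>Displacements and the points visited by a word\<close>

definition displacement :: "step list \<Rightarrow> point" where
  "displacement w = sum_list (map step_vec w)"

lemma displacement_simps [simp]:
  "displacement [] = 0"
  "displacement (s # w) = step_vec s + displacement w"
  "displacement (u @ v) = displacement u + displacement v"
  "displacement (rev w) = displacement w"
  by (simp_all add: displacement_def rev_map[symmetric])

lemma last_vertices: "last (vertices a w) = a + displacement w"
  by (induction w arbitrary: a) (auto simp: add.assoc)

lemma set_vertices_append:
  "set (vertices a (u @ v)) = set (vertices a u) \<union> set (vertices (a + displacement u) v)"
proof (induction u arbitrary: a)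
  case Nil
  show ?case by (cases v) auto
qed (auto simp: add.assoc)

lemma vertices_prefixE:
  assumes "p \<in> set (vertices a w)"
  obtains u v where "w = u @ v" "p = a + displacement u"
  using assms
proof (induction w arbitrary: a thesis)
  case Nil
  then show ?case by simp
next
  case (Cons s w)
  show ?case
  proof (cases "p = a")
    case True
    then show ?thesis using Cons.prems(1)[of "[]" "s # w"] by simp
  next
    case False
    then have "p \<in> set (vertices (a + step_vec s) w)" using Cons.prems(2) by simp
    then obtain u v where "w = u @ v" "p = a + step_vec s + displacement u"
      using Cons.IH by blast
    then show ?thesis using Cons.prems(1)[of "s # u" v] by (simp add: add.assoc)
  qed
qed

section \<open>Levels along a word: record lows and passages\<close>

lemma hdist_add [simp]: "hdist k (p + q) = hdist k p + hdist k q"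
  by (simp add: hdist_def algebra_simps)

lemma hdist_simps [simp]: "hdist k 0 = 0" "hdist k (0, 0) = 0"
  "hdist k (1, 0) = -1" "hdist k (0, 1) = k"
  by (simp_all add: hdist_def)

definition rise :: "int \<Rightarrow> step list \<Rightarrow> int" where
  "rise k w = hdist k (displacement w)"

lemma rise_simps [simp]:
  "rise k [] = 0" "rise k (R # w) = rise k w - 1" "rise k (U # w) = k + rise k w"
  "rise k (u @ v) = rise k u + rise k v" "rise k (rev w) = rise k w"
  by (simp_all add: rise_def)

text \<open>Expresses that \<open>w\<close> ends at a first visit: descents are by one, so a level
  at or below the start is first met as a strict minimum.\<close>

definition record_low :: "int \<Rightarrow> step list \<Rightarrow> bool" where
  "record_low k w \<longleftrightarrow> (\<forall>u v. w = u @ v \<longrightarrow> v \<noteq> [] \<longrightarrow> rise k w < rise k u)"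

text \<open>A prefix of \<open>rev w\<close> reverses a suffix of \<open>w\<close>, and that suffix
  falls from a higher level to the strict minimum; \<open>rise\<close> is invariant under
  reversal.\<close>

lemma record_low_rev_prefix:
  assumes "record_low k w" "rev w = u @ v" "u \<noteq> []"
  shows "rise k u < 0"
proof -
  have "w = rev v @ rev u" using assms(2) by (metis rev_append rev_rev_ident)
  with assms(1,3) have "rise k w < rise k (rev v)"
    unfolding record_low_def by (metis rev_is_Nil_conv)
  then show ?thesis using \<open>w = rev v @ rev u\<close> by simp
qed

lemma record_low_revI:
  assumes "\<And>u v. w = u @ v \<Longrightarrow> u \<noteq> [] \<Longrightarrow> rise k u < 0"
  shows "record_low k (rev w)"
  unfolding record_low_def
proof (intro allI impI)
  fix u v assume "rev w = u @ v" "v \<noteq> []"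
  then have w: "w = rev v @ rev u" by (metis rev_append rev_rev_ident)
  then have "rise k (rev v) < 0" using assms[OF w] \<open>v \<noteq> []\<close> by simp
  then show "rise k (rev w) < rise k u" using w by simp
qed

text \<open>One prefix extends the other, and a proper extension that is a record low would end
  strictly lower.\<close>

lemma record_low_unique:
  assumes "record_low k a" "record_low k a'" "a @ b = a' @ b'" "rise k a = rise k a'"
  shows "a = a'"
proof -
  obtain c where "a = a' @ c \<and> c @ b = b' \<or> a @ c = a' \<and> b = c @ b'"
    using assms(3) by (auto simp: append_eq_append_conv2)
  then show ?thesis using assms(1,2,4) unfolding record_low_def
    by (metis append_Nil2 less_irrefl)
qed

text \<open>Discrete intermediate values: no level is skipped on the way down.\<close>

lemma first_passage_exists:
  assumes "k > 0" "rise k w \<le> c" "c \<le> 0"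
  obtains a b where "w = a @ b" "record_low k a" "rise k a = c"
  using assms(2,3)
proof (induction w arbitrary: c thesis)
  case Nil
  then show ?case by (auto simp: record_low_def)
next
  case (Cons s w)
  show ?case
  proof (cases "c = 0")
    case True
    then show ?thesis using Cons.prems(1)[of "[]" "s # w"] by (auto simp: record_low_def)
  next
    case False
    define d where "d = rise k [s]"
    have s: "rise k (s # u) = d + rise k u" for u unfolding d_def by (cases s) auto
    \<comment> \<open>As \<open>c \<le> -1 \<le> d\<close>, the level \<open>c - d\<close> sought in
      the rest is again at most 0.\<close>
    have "d \<ge> -1" unfolding d_def using \<open>k > 0\<close> by (cases s) auto
    then have "rise k w \<le> c - d" "c - d \<le> 0" using Cons.prems(2,3) False s by auto
    then obtain a b where ab: "w = a @ b" "record_low k a" "rise k a = c - d"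
      using Cons.IH[of "c - d"] by blast
    have "record_low k (s # a)"
      unfolding record_low_def
    proof (intro allI impI)
      fix u v assume uv: "s # a = u @ v" "v \<noteq> []"
      show "rise k (s # a) < rise k u"
      proof (cases u)
        case Nil
        then show ?thesis using s ab(3) Cons.prems(3) False by simp
      next
        case (Cons s' u')
        then have u: "u = s # u'" "a = u' @ v" using uv(1) by auto
        then have "rise k a < rise k u'" using ab(2) uv(2) unfolding record_low_def by blast
        then show ?thesis using u(1) s by simp
      qed
    qed
    then show ?thesis using Cons.prems(1)[of "s # a" b] ab s by simp
  qed
qed

text \<open>Only an up-step can cross from negative to nonnegative levels. It may overshoot 0, so
  the arrival level is bounded, not prescribed.\<close>

lemma first_return_exists:
  assumes "c < 0" "c + rise k w \<ge> 0"
  obtains a b where "w = a @ U # b" "\<And>u v. a = u @ v \<Longrightarrow> c + rise k u < 0"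
    "c + rise k a + k \<ge> 0"
  using assms
proof (induction w arbitrary: c thesis)
  case Nil
  then show ?case by simp
next
  case (Cons s w)
  define d where "d = rise k [s]"
  have s: "rise k (s # u) = d + rise k u" for u unfolding d_def by (cases s) auto
  show ?case
  proof (cases "c + d < 0")
    case True
    moreover have "c + d + rise k w \<ge> 0" using Cons.prems(3) s by simp
    ultimately obtain a b where ab: "w = a @ U # b"
      "\<And>u v. a = u @ v \<Longrightarrow> c + d + rise k u < 0" "c + d + rise k a + k \<ge> 0"
      using Cons.IH[of "c + d"] by blast
    have "c + rise k u < 0" if "s # a = u @ v" for u v
      using that ab(2) Cons.prems(2) s by (auto simp: Cons_eq_append_conv add.assoc)
    then show ?thesis using Cons.prems(1)[of "s # a" b] ab s by (simp add: add.assoc)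
  next
    case False
    then have "s = U" using Cons.prems(2) unfolding d_def by (cases s) auto
    then show ?thesis using Cons.prems(1)[of "[]" w] Cons.prems(2) False by (auto simp: d_def)
  qed
qed

section \<open>Strips and good paths\<close>

locale strip =
  fixes k n i :: int and S :: "point set"
  assumes k: "k > 0" and n: "n > 0" and i: "0 \<le> i" "i < k" and S: "is_strip k n i S"
begin

lemma hdist_target: "hdist k (target k n i) = i"
  by (simp add: target_def hdist_def)

lemma strip_hdist: "p \<in> S \<Longrightarrow> 0 \<le> hdist k p \<and> hdist k p \<le> i"
  using S i unfolding is_strip_def by auto

lemma origin_notin: "0 \<notin> S"
  using S unfolding is_strip_def zero_prod_def by auto

text \<open>The target has level \<open>i\<close>, so the strict bound excludes it.\<close>

lemma below_boundary_in_strip: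
  "p \<noteq> 0 \<Longrightarrow> 0 \<le> hdist k p \<Longrightarrow> hdist k p < i \<Longrightarrow> p \<in> S"
  using S hdist_target unfolding is_strip_def zero_prod_def by auto

abbreviation avoids :: "point \<Rightarrow> step list \<Rightarrow> bool" where
  "avoids p w \<equiv> set (vertices p w) \<inter> S = {}"

lemma good_iff: "w \<in> good_paths k n i S \<longleftrightarrow> displacement w = target k n i \<and> avoids 0 w"
  by (simp add: good_paths_def path_from_to_def last_vertices flip: zero_prod_def)

lemma good_rise: "w \<in> good_paths k n i S \<Longrightarrow> rise k w = i"
  by (simp add: good_iff rise_def hdist_target)

section \<open>Good paths by first step, and the two bijections\<close>

definition up_paths :: "step list set" where
  "up_paths = {w \<in> good_paths k n i S. starts_up w}"

definition right_paths :: "step list set" where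
  "right_paths = {w \<in> good_paths k n i S. \<not> starts_up w}"

text \<open>A pair \<open>(a, b)\<close> encodes both the path \<open>U # a @ b\<close>, marked at its first visit to the level
  \<open>k + rise k a\<close>, and the path \<open>rev a @ U # b\<close>.\<close>

definition split_pairs :: "(step list \<times> step list) set" where
  "split_pairs = {(a, b). record_low k a \<and> rise k a < 0 \<and> i \<le> k + rise k a \<and>
     displacement (U # a @ b) = target k n i \<and> avoids (displacement (U # a)) b}"

text \<open>Between the origin and its end, \<open>U # a\<close> stays strictly above level
  \<open>k + rise k a\<close>, hence above the strip. Its end is also the first vertex of
  \<open>b\<close>.\<close>

lemma up_good_iff:
  assumes "record_low k a" "i \<le> k + rise k a"
  shows "U # a @ b \<in> good_paths k n i S \<longleftrightarrow>
    displacement (U # a @ b) = target k n i \<and> avoids (displacement (U # a)) b"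
proof -
  have "p \<in> set (vertices (displacement (U # a)) b)"
    if "p \<in> set (vertices 0 (U # a))" "p \<in> S" for p
  proof -
    have "p \<in> set (vertices (0, 1) a)" using that origin_notin by auto
    then obtain u v where uv: "a = u @ v" "p = (0, 1) + displacement u"
      by (rule vertices_prefixE)
    have "v = []"
      using assms uv strip_hdist[OF that(2)] unfolding record_low_def
      by (fastforce simp: rise_def)
    then have "p = displacement (U # a)" using uv by simp
    then show ?thesis by (cases b) auto
  qed
  then show ?thesis
    using set_vertices_append[of 0 "U # a" b] origin_notin unfolding good_iff by (simp only: append_Cons) auto
qed

text \<open>After the origin, \<open>rev a\<close> stays at negative levels, below the strip.
  Reversal keeps displacements, so \<open>b\<close> starts at the same point as in
  \<open>U # a @ b\<close>.\<close>

lemma right_good_iff: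
  assumes "record_low k a"
  shows "rev a @ U # b \<in> good_paths k n i S \<longleftrightarrow>
    displacement (U # a @ b) = target k n i \<and> avoids (displacement (U # a)) b"
proof -
  have "p \<notin> S" if p: "p \<in> set (vertices 0 (rev a))" for p
  proof -
    obtain u v where uv: "rev a = u @ v" "p = 0 + displacement u"
      using p by (rule vertices_prefixE)
    show ?thesis
    proof (cases "u = []")
      case True
      then show ?thesis using uv origin_notin by simp
    next
      case False
      then have "rise k u < 0" using record_low_rev_prefix assms uv by blast
      then show ?thesis using uv strip_hdist[of p] by (auto simp: rise_def)
    qed
  qed
  \<comment> \<open>The junction is also the first vertex of \<open>U # b\<close>, and so must be
    known to avoid \<open>S\<close>.\<close>
  moreover have "displacement a \<in> set (vertices 0 (rev a))"
    using last_vertices[of 0 "rev a"] last_in_set[of "vertices 0 (rev a)"] by simp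
  ultimately show ?thesis
    using set_vertices_append[of 0 "rev a" "U # b"] unfolding good_iff
    by (auto simp: ac_simps)
qed

text \<open>A first visit is determined by its level, whence injectivity. Each level in
  \<open>{i..<k}\<close> is visited, since the path goes from level \<open>k\<close> after its first
  step to level \<open>i\<close> at the target.\<close>

lemma up_bij: "bij_betw (\<lambda>(a, b). (k + rise k a, U # a @ b)) split_pairs ({i..<k} \<times> up_paths)"
proof (rule bij_betwI')
  fix x y assume "x \<in> split_pairs" "y \<in> split_pairs"
  then show "((case x of (a, b) \<Rightarrow> (k + rise k a, U # a @ b)) =
      (case y of (a, b) \<Rightarrow> (k + rise k a, U # a @ b))) = (x = y)"
    using record_low_unique[of k "fst x" "fst y" "snd x" "snd y"]
    unfolding split_pairs_def by (cases x; cases y) auto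
next
  fix x assume "x \<in> split_pairs"
  then show "(case x of (a, b) \<Rightarrow> (k + rise k a, U # a @ b)) \<in> {i..<k} \<times> up_paths"
    using up_good_iff[of "fst x" "snd x"]
    by (cases x) (auto simp: split_pairs_def up_paths_def starts_up_def)
next
  fix y assume "y \<in> {i..<k} \<times> up_paths"
  then obtain m v where y: "y = (m, U # v)" "i \<le> m" "m < k" "U # v \<in> good_paths k n i S"
    unfolding up_paths_def starts_up_def by (auto simp: neq_Nil_conv)
  have "rise k v \<le> m - k" using good_rise[OF y(4)] y(2) by simp
  then obtain a b where ab: "v = a @ b" "record_low k a" "rise k a = m - k"
    using first_passage_exists[of k v "m - k"] y(3) k by auto
  then have "(a, b) \<in> split_pairs"
    using y up_good_iff[of a b] by (auto simp: split_pairs_def)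
  then show "\<exists>x\<in>split_pairs. y = (case x of (a, b) \<Rightarrow> (k + rise k a, U # a @ b))"
    using ab y by (intro bexI[of _ "(a, b)"]) auto
qed

text \<open>Nonempty prefixes of \<open>rev a\<close> have negative \<open>rise\<close>, but
  \<open>rev a' @ [U]\<close> has reached 0 or more.\<close>

lemma record_low_not_proper_extension:
  assumes "record_low k a" "rise k a' + k \<ge> 0" "rev a' @ U # c = rev a"
  shows False
proof -
  have "rev a = (rev a' @ [U]) @ c" using assms(3) by simp
  then have "rise k (rev a' @ [U]) < 0" using record_low_rev_prefix[OF assms(1)] by blast
  then show False using assms(2) by simp
qed

text \<open>The marked up-step is the first to bring the path back to a nonnegative level, so its
  position is forced.\<close>

lemma right_split_unique:
  assumes "record_low k a" "record_low k a'" "rise k a + k \<ge> 0" "rise k a' + k \<ge> 0"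
    and eq: "rev a @ U # b = rev a' @ U # b'"
  shows "a = a' \<and> b = b'"
proof -
  obtain c where "rev a = rev a' @ c \<and> c @ U # b = U # b' \<or> rev a @ c = rev a' \<and> U # b = c @ U # b'"
    using eq by (auto simp: append_eq_append_conv2)
  then have "c = []"
    using record_low_not_proper_extension[OF assms(1,4)] record_low_not_proper_extension[OF assms(2,3)]
    by (cases c) auto
  then show ?thesis using \<open>rev a = _ \<and> _ \<or> _\<close> by auto
qed

lemma right_bij: "bij_betw (\<lambda>(a, b). rev a @ U # b) split_pairs right_paths"
proof (rule bij_betwI')
  fix x y assume "x \<in> split_pairs" "y \<in> split_pairs"
  then show "((case x of (a, b) \<Rightarrow> rev a @ U # b) = (case y of (a, b) \<Rightarrow> rev a @ U # b)) = (x = y)"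
    using right_split_unique[of "fst x" "fst y" "snd x" "snd y"] i(1) unfolding split_pairs_def
    by (cases x; cases y) auto
next
  fix x assume "x \<in> split_pairs"
  then obtain a b where x: "x = (a, b)" "(a, b) \<in> split_pairs" by (cases x) auto
  then have a: "record_low k a" "rise k a < 0" by (auto simp: split_pairs_def)
  then have "rev a \<noteq> []" by auto
  then obtain s u where su: "rev a = s # u" by (cases "rev a") auto
  \<comment> \<open>This forces \<open>s = R\<close>, as \<open>U\<close> rises by
    \<open>k > 0\<close>.\<close>
  have "rise k [s] < 0" using record_low_rev_prefix[OF a(1), of "[s]" u] su by simp
  then have "\<not> starts_up (rev a @ U # b)" using su k by (auto simp: starts_up_def)
  then show "(case x of (a, b) \<Rightarrow> rev a @ U # b) \<in> right_paths"
    using x right_good_iff[OF a(1), of b] by (auto simp: split_pairs_def right_paths_def)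
next
  fix y assume "y \<in> right_paths"
  then have y: "y \<in> good_paths k n i S" "\<not> starts_up y" by (auto simp: right_paths_def)
  \<comment> \<open>The empty word does not start up either; it is excluded because the target has
    height \<open>n > 0\<close>.\<close>
  have "y \<noteq> []" using y(1) n by (auto simp: good_iff target_def zero_prod_def)
  then obtain w where w: "y = R # w" using y(2) step.exhaust
    by (metis list.exhaust list.sel(1) list.distinct(1) starts_up_def)
  \<comment> \<open>The initial \<open>R\<close> leads to level -1, and the target has level
    \<open>i \<ge> 0\<close>.\<close>
  then have "-1 + rise k w \<ge> 0" using good_rise[OF y(1)] i(1) by simp
  then obtain r b where rb: "w = r @ U # b" "\<And>u v. r = u @ v \<Longrightarrow> -1 + rise k u < 0"
    "-1 + rise k r + k \<ge> 0"
    using first_return_exists[of "-1" k w] by auto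
  \<comment> \<open>Reversal turns staying below 0 into ending at a record low.\<close>
  define a where "a = rev (R # r)"
  have ya: "y = rev a @ U # b" using w rb(1) by (simp add: a_def)
  have low: "record_low k a" unfolding a_def
  proof (rule record_low_revI)
    fix u v assume "R # r = u @ v" "u \<noteq> []"
    then show "rise k u < 0" using rb(2) by (auto simp: Cons_eq_append_conv)
  qed
  have neg: "rise k a < 0" using rb(2)[of r "[]"] by (simp add: a_def)
  have good: "displacement (U # a @ b) = target k n i" "avoids (displacement (U # a)) b"
    using right_good_iff[OF low, of b] y(1) ya by auto
  have "displacement (U # a) \<notin> S"
    using good(2) by (cases b) auto
  moreover have "hdist k (displacement (U # a)) = k + rise k a" by (simp add: rise_def)
  \<comment> \<open>The origin must be ruled out before \<open>below_boundary_in_strip\<close>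
    applies; the up-step gives positive height.\<close>
  moreover have "displacement (U # a) \<noteq> 0"
  proof -
    have "0 \<le> snd (displacement v)" for v
    proof (induction v)
      case (Cons s v)
      then show ?case by (cases s) auto
    qed simp
    from this[of a] have "snd (displacement (U # a)) > 0" by simp
    then show ?thesis by (metis less_irrefl snd_zero)
  qed
  \<comment> \<open>A point outside \<open>S\<close> at a nonnegative level below \<open>i\<close>
    could only be the origin.\<close>
  ultimately have "i \<le> k + rise k a"
    using below_boundary_in_strip[of "displacement (U # a)"] rb(3) by (force simp: a_def)
  then have "(a, b) \<in> split_pairs" using low neg good by (simp add: split_pairs_def)
  then show "\<exists>x\<in>split_pairs. y = (case x of (a, b) \<Rightarrow> rev a @ U # b)"
    using ya by (intro bexI[of _ "(a, b)"]) auto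
qed

section \<open>Counting\<close>

lemma card_right_paths: "int (card right_paths) = (k - i) * int (card up_paths)"
proof -
  \<comment> \<open>Both bijections have domain \<open>split_pairs\<close>; the factor
    \<open>k - i\<close> counts the levels in \<open>{i..<k}\<close>.\<close>
  have "card right_paths = card ({i..<k} \<times> up_paths)"
    using bij_betw_same_card[OF up_bij] bij_betw_same_card[OF right_bij] by simp
  then show ?thesis using i by (simp add: card_cartesian_product)
qed

lemma card_good_paths: "int (card (good_paths k n i S)) = (k + 1 - i) * int (card up_paths)"
proof -
  have "good_paths k n i S = up_paths \<union> right_paths" "up_paths \<inter> right_paths = {}"
    by (auto simp: up_paths_def right_paths_def)
  then have "card (good_paths k n i S) = card up_paths + card right_paths"
    using finite_good_paths[of k n i S] card_Un_disjoint[of up_paths right_paths] by simp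
  then show ?thesis using card_right_paths by (simp add: algebra_simps)
qed

end

theorem corollary5:
  fixes k n i :: int and S :: "(int \<times> int) set"
  assumes "k > 0" and "n > 0" and "0 \<le> i" and "i < k"
    and "is_strip k n i S"
  shows "int (card (good_paths k n i S)) =
         (k + 1 - i) * int (card {w \<in> good_paths k n i S. starts_up w})"
proof -
  interpret strip k n i S using assms by unfold_locales
  show ?thesis using card_good_paths unfolding up_paths_def .
qed

end
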